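(* Let $G=(V,E)$ be a finite simple graph whose edges are colored red, green and blue, each edge receiving exactly one color. Let $R$, $G$, $B$ denote the numbers of red, green and blue edges, respectively, and let $T$ be the number of rainbow triangles in the graph. Then $T^2\leq 2RGB$.
   Context: A rainbow triangle is a set of three vertices that are pairwise adjacent and whose three connecting edges have three distinct colors (one red, one green, one blue). Simple means there are no loops and no multiple edges. *)

theory Defs
  imports Main
begin

datatype colour = Red | Green | Blue

definition finite_simple_graph :: "'a set \<Rightarrow> 'a set set \<Rightarrow> bool" where
  "finite_simple_graph V E \<longleftrightarrow> finite V \<and> (\<forall>e\<in>E. e \<subseteq> V \<and> card e = 2)"

(* The colouring is a total function; its values outside E are never used. *)
definition colour_class :: "'a set set \<Rightarrow> ('a set \<Rightarrow> colour) \<Rightarrow> colour \<Rightarrow> 'a set set" where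
  "colour_class E c k = {e \<in> E. c e = k}"

(* Triangles are unordered vertex sets, so each is counted once. *)
definition rainbow_triangles ::
    "'a set \<Rightarrow> 'a set set \<Rightarrow> ('a set \<Rightarrow> colour) \<Rightarrow> 'a set set" where
  "rainbow_triangles V E c =
     {{x, y, z} | x y z. x \<in> V \<and> y \<in> V \<and> z \<in> V \<and> distinct [x, y, z] \<and>
        {x, y} \<in> E \<and> {y, z} \<in> E \<and> {x, z} \<in> E \<and>
        distinct [c {x, y}, c {y, z}, c {x, z}]}"

end

theory Submission
  imports Defs "HOL-Analysis.Convex"
begin

text \<open>Count tuples \<open>(x, y, v)\<close> with \<open>xy\<close> blue, \<open>xv\<close> red and \<open>vy\<close> green. There are \<open>2B\<close> ordered
  blue pairs \<open>(x, y)\<close>, so by Cauchy-Schwarz \<open>T\<^sup>2\<close> is at most \<open>2B\<close> times the number of tuples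
  \<open>(x, y, v, w)\<close> in which both \<open>v\<close> and \<open>w\<close> complete \<open>(x, y)\<close> to such a triangle. Sending such a
  tuple to the red edge \<open>xv\<close> and the green edge \<open>wy\<close> is injective: reversing one of these edges
  or both would force two colours on one edge, so there are at most \<open>RG\<close> such tuples.\<close>

definition apexes :: "'a set set \<Rightarrow> 'a set set \<Rightarrow> 'a \<times> 'a \<Rightarrow> 'a set" where
  "apexes R G p = {v. {fst p, v} \<in> R \<and> {v, snd p} \<in> G}"

definition ordered_pairs :: "'a set set \<Rightarrow> ('a \<times> 'a) set" where
  "ordered_pairs B = {(x, y). {x, y} \<in> B}"

text \<open>Each set in \<open>B\<close> has at most two orientations. This is only an upper bound
  because \<open>B\<close> is arbitrary here: a singleton comes from one pair, and a set with no or
  more than two elements from none.\<close>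

lemma ordered_pairs_finite_card:
  assumes "finite B"
  shows "finite (ordered_pairs B)" and "card (ordered_pairs B) \<le> 2 * card B"
proof -
  have eq: "ordered_pairs B = (\<Union>e\<in>B. {(x, y). {x, y} = e})"
    by (auto simp: ordered_pairs_def)
  have fibre: "finite {(x, y). {x, y} = e} \<and> card {(x, y). {x, y} = e} \<le> 2" for e :: "'a set"
  proof (cases "\<exists>a b. e = {a, b}")
    case True
    then obtain a b where e: "e = {a, b}" by blast
    have "{(x, y). {x, y} = e} \<subseteq> {(a, b), (b, a)}"
      unfolding e doubleton_eq_iff by blast
    moreover have "card {(a, b), (b, a)} \<le> 2"
      using card_length[of "[(a, b), (b, a)]"] by simp
    ultimately show ?thesis
      by (meson card_mono finite.emptyI finite.insertI finite_subset le_trans)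
  next
    case False
    then have e: "{(x, y). {x, y} = e} = {}" by blast
    show ?thesis unfolding e by simp
  qed
  show "finite (ordered_pairs B)"
    unfolding eq using assms fibre by blast
  have "card (ordered_pairs B) \<le> (\<Sum>e\<in>B. card {(x, y). {x, y} = e})"
    unfolding eq by (rule card_UN_le[OF assms])
  also have "\<dots> \<le> (\<Sum>e\<in>B. 2)"
    using fibre by (intro sum_mono) blast
  finally show "card (ordered_pairs B) \<le> 2 * card B" by simp
qed

lemma finite_apexes:
  assumes "finite R" "\<And>e. e \<in> R \<Longrightarrow> finite e"
  shows "finite (apexes R G p)"
  by (rule finite_subset[of _ "\<Union>R"]) (use assms in \<open>auto simp: apexes_def\<close>)

lemma sum_apexes_squared_le:
  assumes "finite R" "finite G" "finite B" "\<And>e. e \<in> R \<Longrightarrow> finite e"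
    and disj: "R \<inter> G = {}" "R \<inter> B = {}" "G \<inter> B = {}"
  shows "(\<Sum>p\<in>ordered_pairs B. (card (apexes R G p))\<^sup>2) \<le> card R * card G"
proof -
  let ?Q = "SIGMA p : ordered_pairs B. apexes R G p \<times> apexes R G p"
  \<comment> \<open>The image keeps the red edge at \<open>v\<close> and the green edge at
    \<open>w\<close>; the colours of \<open>{x, y}\<close>, \<open>{x, w}\<close> and
    \<open>{v, y}\<close> remain available to fix the orientations.\<close>
  let ?h = "\<lambda>((x, y), v, w). ({x, v}, {w, y})"
  have determined: "x = x' \<and> y = y' \<and> v = v' \<and> w = w'"
    if "{x, y} \<in> B" "{x, w} \<in> R" "{v, y} \<in> G" "{x', y'} \<in> B" "{x', w'} \<in> R" "{v', y'} \<in> G"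
      and "{x, v} = {x', v'}" "{w, y} = {w', y'}"
    for x y v w x' y' v' w'
    \<comment> \<open>Reversing only the first edge makes \<open>{v, y}\<close> both green and blue,
      reversing only the second makes \<open>{x, w}\<close> both red and blue, and reversing both
      makes \<open>{x, w}\<close> both red and green.\<close>
    using that disj by (metis IntI doubleton_eq_iff empty_iff)
  have "inj_on ?h ?Q"
  proof (rule inj_onI)
    fix p q assume pq: "p \<in> ?Q" "q \<in> ?Q" "?h p = ?h q"
    obtain x y v w where p: "p = ((x, y), v, w)" by (metis surj_pair)
    obtain x' y' v' w' where q: "q = ((x', y'), v', w')" by (metis surj_pair)
    have mem: "{x, y} \<in> B" "{x, w} \<in> R" "{v, y} \<in> G" "{x', y'} \<in> B" "{x', w'} \<in> R" "{v', y'} \<in> G"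
      using pq(1,2) unfolding p q by (simp_all add: ordered_pairs_def apexes_def)
    have "{x, v} = {x', v'}" "{w, y} = {w', y'}"
      using pq(3) unfolding p q by (simp_all only: prod.case prod.inject)
    from determined[OF mem this] show "p = q"
      by (simp only: p q)
  qed
  moreover have "?h ` ?Q \<subseteq> R \<times> G"
    by (auto simp: apexes_def)
  ultimately have "card ?Q \<le> card (R \<times> G)"
    using assms by (intro card_inj_on_le) auto
  moreover have "card ?Q = (\<Sum>p\<in>ordered_pairs B. (card (apexes R G p))\<^sup>2)"
    using assms by (simp add: ordered_pairs_finite_card finite_apexes
        card_cartesian_product power2_eq_square)
  ultimately show ?thesis by (simp add: card_cartesian_product)
qed

theorem theorem1p1:
  fixes V :: "'a set" and E :: "'a set set" and c :: "'a set \<Rightarrow> colour"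
  assumes "finite_simple_graph V E"
  shows "(card (rainbow_triangles V E c))\<^sup>2
    \<le> 2 * card (colour_class E c Red) * card (colour_class E c Green) * card (colour_class E c Blue)"
proof -
  define R where "R = colour_class E c Red"
  define G where "G = colour_class E c Green"
  define B where "B = colour_class E c Blue"
  note defs = R_def G_def B_def colour_class_def
  have "E \<subseteq> Pow V" "finite V"
    using assms by (auto simp: finite_simple_graph_def)
  then have fin_E: "finite E" "\<And>e. e \<in> E \<Longrightarrow> finite e"
    by (auto intro: finite_subset)
  then have fin: "finite R" "finite G" "finite B" "\<And>e. e \<in> R \<Longrightarrow> finite e"
    by (auto simp: defs)
  let ?S = "Sigma (ordered_pairs B) (apexes R G)"
  let ?N = "\<lambda>p. card (apexes R G p)"
  \<comment> \<open>Orient the blue edge so that it starts at its common vertex with the red edge;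
    the third vertex is then an apex.\<close>
  have "rainbow_triangles V E c \<subseteq> (\<lambda>((x, y), v). {x, y, v}) ` ?S"
  proof
    fix t assume "t \<in> rainbow_triangles V E c"
    then obtain x y z where t: "t = {x, y, z}"
      and e: "{x, y} \<in> E" "{y, z} \<in> E" "{x, z} \<in> E"
      and col: "distinct [c {x, y}, c {y, z}, c {x, z}]"
      unfolding rainbow_triangles_def by blast
    have hit: "t \<in> (\<lambda>((x, y), v). {x, y, v}) ` ?S"
      if "t = {a, b, d}" "{a, b} \<in> B" "{a, d} \<in> R" "{d, b} \<in> G" for a b d
      using that by (intro image_eqI[of _ _ "((a, b), d)"]) (auto simp: ordered_pairs_def apexes_def)
    have sym: "{y, x} = {x, y}" "{z, y} = {y, z}" "{z, x} = {x, z}"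
      by blast+
    \<comment> \<open>With \<open>t\<close> itself these are the six vertex orders, one for each way
      to distribute three distinct colours over the edges.\<close>
    have perm: "t = {y, x, z}" "t = {x, z, y}" "t = {z, x, y}" "t = {y, z, x}" "t = {z, y, x}"
      using t by blast+
    show "t \<in> (\<lambda>((x, y), v). {x, y, v}) ` ?S"
      using col e hit[OF t] hit[OF perm(1)] hit[OF perm(2)] hit[OF perm(3)] hit[OF perm(4)]
        hit[OF perm(5)]
      unfolding defs sym
      by (cases "c {x, y}"; cases "c {y, z}"; cases "c {x, z}") simp_all
  qed
  then have "card (rainbow_triangles V E c) \<le> card ?S"
    using fin by (intro surj_card_le) (simp_all add: ordered_pairs_finite_card finite_apexes)
  also have "\<dots> = (\<Sum>p\<in>ordered_pairs B. ?N p)"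
    using fin by (simp add: ordered_pairs_finite_card finite_apexes)
  finally have "(card (rainbow_triangles V E c))\<^sup>2 \<le> (\<Sum>p\<in>ordered_pairs B. ?N p)\<^sup>2"
    by (rule power_mono) simp
  \<comment> \<open>Cauchy-Schwarz against the constant 1, applied over the reals and pulled back to
    the naturals.\<close>
  also have "\<dots> \<le> (\<Sum>p\<in>ordered_pairs B. (?N p)\<^sup>2) * card (ordered_pairs B)"
  proof -
    have "real ((\<Sum>p\<in>ordered_pairs B. ?N p)\<^sup>2)
        \<le> real ((\<Sum>p\<in>ordered_pairs B. (?N p)\<^sup>2) * card (ordered_pairs B))"
      using sum_squared_le_sum_of_squares[of "\<lambda>p. real (?N p)" "ordered_pairs B"] by simp
    then show ?thesis by (simp only: of_nat_le_iff)
  qed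
  \<comment> \<open>The classes are disjoint because \<open>c\<close> gives each edge a single
    colour.\<close>
  also have "\<dots> \<le> (card R * card G) * (2 * card B)"
    using fin by (intro mult_mono sum_apexes_squared_le ordered_pairs_finite_card) (auto simp: defs)
  finally show ?thesis by (simp add: R_def G_def B_def mult_ac)
qed

end
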